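(* Let $q$ be a natural number and $k$ an integer with $\gcd(k,q)=1$. If $k/q$ is the value of a normalized Dedekind sum, i.e. $k/q=S(a,b)$ for some $a\in\mathbb{Z}$, $b\in\mathbb{N}$ with $\gcd(a,b)=1$, then for every integer $k'$ with $k'\equiv k \pmod{(q^2-1)q}$, the number $k'/q$ is also the value of a normalized Dedekind sum.
   Context: For $x\in\mathbb{R}$ let $((x))=x-\lfloor x\rfloor-1/2$ if $x\notin\mathbb{Z}$ and $((x))=0$ if $x\in\mathbb{Z}$. For $a\in\mathbb{Z}$, $b\in\mathbb{N}$ with $\gcd(a,b)=1$, the classical Dedekind sum is $s(a,b)=\sum_{j=1}^{b}((j/b))((aj/b))$, and the normalized Dedekind sum is $S(a,b)=12\,s(a,b)$. A rational number is "the value of a normalized Dedekind sum" if it equals $S(a,b)$ for some such $a,b$. *)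

theory Defs
  imports Complex_Main "HOL-Number_Theory.Cong"
begin

definition sawtooth :: "real \<Rightarrow> real" where
  "sawtooth x = (if x \<in> \<int> then 0 else x - of_int \<lfloor>x\<rfloor> - 1 / 2)"

definition dedekind_sum :: "int \<Rightarrow> nat \<Rightarrow> real" where
  "dedekind_sum a b =
     (\<Sum>j = 1..b. sawtooth (real j / real b) * sawtooth (of_int a * real j / real b))"

definition normalized_dedekind_sum :: "int \<Rightarrow> nat \<Rightarrow> real" where
  "normalized_dedekind_sum a b = 12 * dedekind_sum a b"

definition normalized_dedekind_value :: "real \<Rightarrow> bool" where
  "normalized_dedekind_value r \<longleftrightarrow>
     (\<exists>(a::int) (b::nat). b > 0 \<and> coprime a (int b) \<and> r = normalized_dedekind_sum a b)"

end

theory Submission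
  imports Defs
begin

text \<open>
  If \<open>S(a, b) = k/q\<close> in lowest terms with \<open>a > 0\<close>, then \<open>a\<cdot>b\<cdot>S(a, b) \<equiv> a\<^sup>2 + 1 (mod b)\<close> forces
  \<open>b = qg\<close> and \<open>a\<^sup>2 + 1 = gh\<close> with \<open>h\<close> coprime to \<open>q\<close>. The reciprocity law for \<open>(a, b)\<close> combined
  with Rademacher's three-term relation for \<open>(a, h, q)\<close> gives
  \<open>S(a, qg) = (q\<^sup>2 - 1) a / (qh) + R\<close>, where \<open>R\<close> depends only on \<open>q\<close>, \<open>h\<close> and \<open>a mod qh\<close>.
  Replacing \<open>a\<close> by \<open>a + qhm\<close> while keeping \<open>q\<close> and \<open>h\<close> therefore shifts the value by \<open>(q\<^sup>2 - 1) m\<close>;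
  negative \<open>m\<close> are reached through \<open>S(-a, b) = -S(a, b)\<close>.

  The three-term relation comes from telescoping, over \<open>i < abc\<close>, the product of the values of
  \<open>((ax))\<close>, \<open>((bx))\<close>, \<open>((cx))\<close> at the midpoints \<open>x = (i + 1/2)/(abc)\<close>.
\<close>

section \<open>Elementary properties of the sawtooth function\<close>

lemma sawtooth_add_of_int: "sawtooth (x + of_int n) = sawtooth x"
proof -
  have "x + of_int n \<in> \<int> \<longleftrightarrow> x \<in> \<int>"
    by (metis Ints_add Ints_diff Ints_of_int add_diff_cancel_right')
  then show ?thesis
    by (simp add: sawtooth_def)
qed

lemma sawtooth_add_of_nat: "sawtooth (x + of_nat n) = sawtooth x"
  using sawtooth_add_of_int[of x "int n"] by simp

lemma sawtooth_uminus: "sawtooth (- x) = - sawtooth x"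
proof (cases "x \<in> \<int>")
  case True
  then show ?thesis by (simp add: sawtooth_def)
next
  case False
  then have "- x \<notin> \<int>" by simp
  moreover have "\<lfloor>- x\<rfloor> = - \<lfloor>x\<rfloor> - 1"
    using False by (simp add: floor_minus ceiling_altdef) (metis Ints_of_int)
  ultimately show ?thesis
    using False by (simp add: sawtooth_def)
qed

lemma sawtooth_of_nat [simp]: "sawtooth (of_nat n) = 0"
  by (simp add: sawtooth_def)

lemma sawtooth_0 [simp]: "sawtooth 0 = 0"
  by (simp add: sawtooth_def)

lemma sawtooth_unit_interval:
  assumes "0 < x" "x < 1"
  shows "sawtooth x = x - 1 / 2"
proof -
  have "\<lfloor>x\<rfloor> = 0" using assms by linarith
  moreover have "x \<notin> \<int>"
    using assms by (metis Ints_cases \<open>\<lfloor>x\<rfloor> = 0\<close> floor_of_int of_int_0 less_irrefl)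
  ultimately show ?thesis by (simp add: sawtooth_def)
qed

lemma sawtooth_mod:
  assumes "n > 0"
  shows "sawtooth (real (m mod n) / real n) = sawtooth (real m / real n)"
proof -
  have "real m = real (m mod n) + real n * real (m div n)"
    by (metis mod_mult_div_eq of_nat_add of_nat_mult)
  then have "real m / real n = real (m mod n) / real n + real (m div n)"
    using assms by (simp add: field_simps)
  then show ?thesis
    by (simp add: sawtooth_add_of_nat)
qed

lemma sawtooth_nat_quotient:
  assumes "n > 0"
  shows "sawtooth (real m / real n) =
    (if n dvd m then 0 else real (m mod n) / real n - 1 / 2)"
proof (cases "n dvd m")
  case True
  then show ?thesis using sawtooth_mod[OF assms, of m] by simp
next
  case False
  then have "0 < m mod n" "m mod n < n"
    using assms by (auto simp: mod_greater_zero_iff_not_dvd)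
  then have "sawtooth (real (m mod n) / real n) = real (m mod n) / real n - 1 / 2"
    by (intro sawtooth_unit_interval) auto
  then show ?thesis
    using False by (simp add: sawtooth_mod[OF assms])
qed

section \<open>Distribution relation and regrouping of sums by residues\<close>

lemma sum_of_nat_lessThan: "(\<Sum>t<n. real t) = real n * (real n - 1) / 2"
  by (induction n) (auto simp: field_simps)

lemma sum_of_nat_squares_lessThan:
  "(\<Sum>t<n. (real t)\<^sup>2) = real n * (real n - 1) * (2 * real n - 1) / 6"
  by (induction n) (auto simp: field_simps power2_eq_square)

text \<open>All arguments lie in \<open>[0, 1)\<close>, where the sawtooth is linear apart from its
  value at 0, so the sum reduces to that of an arithmetic progression.\<close>

lemma sawtooth_distribution:
  assumes "l < a" "c > 0"
  shows "(\<Sum>t<c. sawtooth (real (l + a * t) / real (a * c))) = sawtooth (real l / real a)"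
proof -
  have less: "l + a * t < a * c" if "t < c" for t
  proof -
    have "l + a * t < a * Suc t" using assms by simp
    also have "\<dots> \<le> a * c" using that by (intro mult_le_mono2) simp
    finally show ?thesis .
  qed
  \<comment> \<open>At \<open>l = t = 0\<close> the linear formula would give -1/2, while
    \<open>sawtooth 0 = 0\<close>; the last term corrects this.\<close>
  have summand: "sawtooth (real (l + a * t) / real (a * c)) =
      (real l / real a + real t) / real c - 1 / 2 + (if l = 0 \<and> t = 0 then 1 / 2 else 0)"
    if "t < c" for t
  proof (cases "l = 0 \<and> t = 0")
    case True
    then show ?thesis by simp
  next
    case False
    then have "0 < l + a * t" using assms by auto
    then have "sawtooth (real (l + a * t) / real (a * c)) = real (l + a * t) / real (a * c) - 1 / 2"
      using less[OF that] sawtooth_nat_quotient[of "a * c" "l + a * t"] assms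
      by (simp only: nat_dvd_not_less if_False mod_less nat_0_less_mult_iff) auto
    moreover have "real (l + a * t) / real (a * c) = (real l / real a + real t) / real c"
      using assms by (simp add: field_simps)
    ultimately show ?thesis using False by (simp only: if_False add_0_right)
  qed
  have "(\<Sum>t<c. sawtooth (real (l + a * t) / real (a * c))) =
      (\<Sum>t<c. (real l / real a + real t) / real c - 1 / 2 + (if l = 0 \<and> t = 0 then 1 / 2 else 0))"
    by (intro sum.cong refl summand) simp
  also have "\<dots> = real l / real a - 1 / 2 + (if l = 0 then 1 / 2 else 0)"
  proof -
    have "(\<Sum>t<c. (if l = 0 \<and> t = 0 then 1 / 2 else 0 :: real)) = (if l = 0 then 1 / 2 else 0)"
      using assms by (cases "l = 0") (auto simp: sum.delta')
    moreover have "(\<Sum>t<c. (real l / real a + real t) / real c - 1 / 2) =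
        (real c * (real l / real a) + real c * (real c - 1) / 2) / real c - real c / 2"
      by (simp add: sum.distrib sum_subtractf sum_of_nat_lessThan flip: sum_divide_distrib)
    ultimately show ?thesis
      using assms by (simp only: sum.distrib) (simp add: field_simps)
  qed
  also have "\<dots> = sawtooth (real l / real a)"
    using assms sawtooth_unit_interval[of "real l / real a"] by auto
  finally show ?thesis .
qed

lemma bij_betw_chinese_remainder:
  fixes b c :: nat
  assumes "coprime b c" "b > 0" "c > 0"
  shows "bij_betw (\<lambda>t. (t mod b, t mod c)) {..<b * c} ({..<b} \<times> {..<c})"
proof -
  have inj: "inj_on (\<lambda>t. (t mod b, t mod c)) {..<b * c}"
  proof (rule inj_onI)
    fix x y assume *: "x \<in> {..<b * c}" "y \<in> {..<b * c}" "(x mod b, x mod c) = (y mod b, y mod c)"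
    then have "[x = y] (mod b * c)"
      using assms by (intro coprime_cong_mult_nat) (auto simp: cong_def)
    then show "x = y" using * by (simp add: cong_def)
  qed
  moreover have "(\<lambda>t. (t mod b, t mod c)) ` {..<b * c} = {..<b} \<times> {..<c}"
    using assms by (intro card_subset_eq) (auto simp: card_image[OF inj])
  ultimately show ?thesis by (simp add: bij_betw_def)
qed

text \<open>Groups the indices by residue \<open>l\<close> modulo \<open>a\<close>, leaving the
  quotient \<open>t\<close> free for the Chinese remainder theorem.\<close>

lemma sum_lessThan_mult:
  fixes f :: "nat \<Rightarrow> real"
  assumes "a > 0"
  shows "(\<Sum>i<a * n. f i) = (\<Sum>l<a. \<Sum>t<n. f (l + a * t))"
proof (induction n)
  case (Suc n)
  have "(\<Sum>i<m + k. f i) = (\<Sum>i<m. f i) + (\<Sum>l<k. f (l + m))" for m k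
    by (induction k) (simp_all add: add.commute)
  from this[of "a * n" a]
  have "(\<Sum>i<a * n + a. f i) = (\<Sum>i<a * n. f i) + (\<Sum>l<a. f (l + a * n))" .
  then show ?case
    using Suc by (simp add: sum.distrib add.commute)
qed simp

section \<open>Homogeneous Dedekind sums and the sum of products over a period\<close>

text \<open>Rademacher's generalized Dedekind sum, symmetric in \<open>x\<close> and
  \<open>y\<close>. The range starts at 0, where the term vanishes, so that it is a full set of
  residues modulo \<open>z\<close>.\<close>

definition dedekind_product_sum :: "nat \<Rightarrow> nat \<Rightarrow> nat \<Rightarrow> real" where
  "dedekind_product_sum x y z =
     (\<Sum>j<z. sawtooth (real (x * j) / real z) * sawtooth (real (y * j) / real z))"

lemma sum_sawtooth_squares:
  assumes "a > 0"
  shows "(\<Sum>l<a. (sawtooth (real l / real a))\<^sup>2) = (real a - 1) * (real a - 2) / (12 * real a)"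
proof -
  \<comment> \<open>The subtracted 1/4 is the square of the value -1/2 that the linear formula would
    give at \<open>l = 0\<close>.\<close>
  have "(\<Sum>l<a. (sawtooth (real l / real a))\<^sup>2) =
      (\<Sum>l<a. (real l)\<^sup>2 / (real a)\<^sup>2 - real l / real a + 1 / 4 - (if l = 0 then 1 / 4 else 0))"
  proof (intro sum.cong refl)
    fix l assume "l \<in> {..<a}"
    then show "(sawtooth (real l / real a))\<^sup>2 =
        (real l)\<^sup>2 / (real a)\<^sup>2 - real l / real a + 1 / 4 - (if l = 0 then 1 / 4 else 0)"
      by (cases "l = 0") (simp_all add: sawtooth_unit_interval power2_diff power_divide)
  qed
  also have "\<dots> = real a * (real a - 1) * (2 * real a - 1) / 6 / (real a)\<^sup>2
      - real a * (real a - 1) / 2 / real a + real a / 4 - 1 / 4"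
    using assms
    by (simp add: sum.distrib sum_subtractf sum_of_nat_lessThan sum_of_nat_squares_lessThan
        flip: sum_divide_distrib)
  also have "\<dots> = (real a - 1) * (real a - 2) / (12 * real a)"
    using assms by (simp add: field_simps power2_eq_square)
  finally show ?thesis .
qed

text \<open>Write \<open>i = l + a * t\<close>. For fixed \<open>l\<close> the two factors depend
  only on \<open>t mod c\<close> and \<open>t mod b\<close>, so the Chinese remainder theorem turns
  the sum over \<open>t\<close> into a product of two sums. By the distribution relation each equals
  \<open>sawtooth (l / a)\<close>, and the sum of squares over \<open>l\<close> remains.\<close>

lemma sum_sawtooth_mult:
  assumes "a > 0" "b > 0" "c > 0" "coprime b c"
  shows "(\<Sum>i<a * (b * c). sawtooth (real i / real (a * c)) * sawtooth (real i / real (a * b))) =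
    (real a - 1) * (real a - 2) / (12 * real a)"
proof -
  define f where "f n l t = sawtooth (real (l + a * t) / real (a * n))" for n l t
  have f_mod: "f n l (t mod n) = f n l t" if "n > 0" for n l t
  proof -
    have "(l + a * (t mod n)) mod (a * n) = (l + a * t) mod (a * n)"
      by (metis mod_add_right_eq mult_mod_right)
    then show ?thesis
      unfolding f_def using sawtooth_mod[of "a * n"] that assms(1)
      by (metis mult_pos_pos)
  qed
  have "(\<Sum>t<b * c. f c l t * f b l t) = (sawtooth (real l / real a))\<^sup>2" if "l < a" for l
  proof -
    have "(\<Sum>t<b * c. f c l t * f b l t) =
        (\<Sum>t<b * c. (\<lambda>(u, v). f c l v * f b l u) (t mod b, t mod c))"
      using assms by (simp add: f_mod)
    also have "\<dots> = (\<Sum>(u, v)\<in>{..<b} \<times> {..<c}. f c l v * f b l u)"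
      by (rule sum.reindex_bij_betw[OF bij_betw_chinese_remainder]) (use assms in auto)
    also have "\<dots> = (\<Sum>u<b. f b l u) * (\<Sum>v<c. f c l v)"
      by (simp add: sum_product sum.cartesian_product mult.commute)
    also have "\<dots> = (sawtooth (real l / real a))\<^sup>2"
      using sawtooth_distribution that assms by (simp add: f_def power2_eq_square)
    finally show ?thesis .
  qed
  then show ?thesis
    using sum_sawtooth_squares[OF assms(1)] assms(1)
    by (simp add: sum_lessThan_mult f_def)
qed

section \<open>Midpoint values and the three-term relation\<close>

text \<open>The value \<open>(((i + 1/2)/n))\<close>: from \<open>i/n\<close> the sawtooth rises by \<open>1/(2n)\<close>, after half of its
  jump if \<open>n\<close> divides \<open>i\<close>.\<close>

definition sawtooth_mid :: "nat \<Rightarrow> nat \<Rightarrow> real" where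
  "sawtooth_mid n i = sawtooth (real i / real n) + (1 / real n - of_bool (n dvd i)) / 2"

lemma sawtooth_mid_eq_mod:
  assumes "n > 0"
  shows "sawtooth_mid n i = real (i mod n) / real n - 1 / 2 + 1 / (2 * real n)"
  using assms by (auto simp: sawtooth_mid_def sawtooth_nat_quotient field_simps)

text \<open>The same midpoint value, reached from its right neighbour \<open>(i + 1) / n\<close>
  instead of the left one. Together with the definition it expresses two consecutive midpoint values
  through data at the single point between them.\<close>

lemma sawtooth_mid_eq_Suc:
  assumes "n > 0"
  shows "sawtooth_mid n i =
    sawtooth (real (Suc i) / real n) - (1 / real n - of_bool (n dvd Suc i)) / 2"
proof -
  have "sawtooth (real (Suc i) / real n) - (1 / real n - of_bool (n dvd Suc i)) / 2 =
      real (Suc i mod n) / real n - 1 / 2 + of_bool (n dvd Suc i) - 1 / (2 * real n)"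
    using assms by (auto simp: sawtooth_nat_quotient field_simps simp del: of_nat_Suc)
  also have "\<dots> = real (i mod n) / real n - 1 / 2 + 1 / (2 * real n)"
  proof (cases "Suc (i mod n) = n")
    case True
    then have "Suc i mod n = 0" by (simp add: mod_Suc)
    moreover have "real (i mod n) = real n - 1"
      using True by (metis diff_Suc_1 of_nat_1 of_nat_diff le_add1 plus_1_eq_Suc)
    ultimately show ?thesis using assms by (simp add: dvd_eq_mod_eq_0 field_simps)
  next
    case False
    then have "Suc i mod n = Suc (i mod n)" by (simp add: mod_Suc)
    then show ?thesis using assms by (simp add: dvd_eq_mod_eq_0 field_simps)
  qed
  finally show ?thesis by (simp add: sawtooth_mid_eq_mod[OF assms])
qed

lemma sum_of_bool_dvd_mult:
  fixes f :: "nat \<Rightarrow> real"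
  assumes "n > 0"
  shows "(\<Sum>i<a * n. of_bool (n dvd i) * f i) = (\<Sum>j<a. f (n * j))"
proof -
  have "(\<Sum>t<a. of_bool (n dvd l + n * t) * f (l + n * t)) =
      (if l = 0 then \<Sum>t<a. f (n * t) else 0)" if "l < n" for l
  proof -
    have "n dvd l + n * t \<longleftrightarrow> l = 0" for t
      using that by (auto simp: dvd_add_left_iff dest: dvd_imp_le)
    then show ?thesis by simp
  qed
  then have "(\<Sum>l<n. \<Sum>t<a. of_bool (n dvd l + n * t) * f (l + n * t)) =
      (\<Sum>l<n. if l = 0 then \<Sum>t<a. f (n * t) else 0)"
    by (intro sum.cong) simp_all
  then show ?thesis
    unfolding mult.commute[of a n] sum_lessThan_mult[OF assms] using assms by simp
qed

text \<open>The constant part of the jump is a multiple of \<open>sum_sawtooth_mult\<close>. The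
  indicator selects \<open>i = b * c * j\<close>, where the arguments become
  \<open>b * j / a\<close> and \<open>c * j / a\<close>.\<close>

lemma sum_jump_sawtooth_mult:
  assumes "a > 0" "b > 0" "c > 0" "coprime b c"
  shows "(\<Sum>i<a * (b * c). (1 / real (b * c) - of_bool (b * c dvd i)) *
      (sawtooth (real i / real (a * c)) * sawtooth (real i / real (a * b)))) =
    (real a - 1) * (real a - 2) / (12 * real a * real b * real c) - dedekind_product_sum b c a"
proof -
  have *: "sawtooth (real (b * c * j) / real (a * c)) * sawtooth (real (b * c * j) / real (a * b)) =
      sawtooth (real (b * j) / real a) * sawtooth (real (c * j) / real a)" for j
  proof -
    have "real (b * c * j) / real (a * c) = real (b * j) / real a"
         "real (b * c * j) / real (a * b) = real (c * j) / real a"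
      using assms by (simp_all add: field_simps)
    then show ?thesis by simp
  qed
  have "(\<Sum>i<a * (b * c). of_bool (b * c dvd i) *
      (sawtooth (real i / real (a * c)) * sawtooth (real i / real (a * b)))) =
      dedekind_product_sum b c a"
    using assms by (subst sum_of_bool_dvd_mult) (simp_all only: * dedekind_product_sum_def, simp_all)
  moreover have "(\<Sum>i<a * (b * c). 1 / real (b * c) *
      (sawtooth (real i / real (a * c)) * sawtooth (real i / real (a * b)))) =
      1 / real (b * c) * ((real a - 1) * (real a - 2) / (12 * real a))"
    by (subst sum_distrib_left[symmetric], subst sum_sawtooth_mult) (use assms in auto)
  ultimately show ?thesis
    using assms by (simp only: left_diff_distrib sum_subtractf) (simp add: field_simps)
qed

text \<open>Once the common factor \<open>c\<close> is removed, the coprime \<open>a\<close> and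
  \<open>b\<close> both divide the quotient, hence so does their product. This collapses products of
  divisibility indicators.\<close>

lemma mult_dvd_and_mult_dvd_iff:
  fixes a b c i :: nat
  assumes "coprime a b"
  shows "b * c dvd i \<and> a * c dvd i \<longleftrightarrow> a * (b * c) dvd i"
proof (intro iffI conjI)
  assume *: "b * c dvd i \<and> a * c dvd i"
  then obtain k where k: "i = c * k" by (metis dvd_def dvd_mult_right)
  show "a * (b * c) dvd i"
  proof (cases "c = 0")
    case False
    then have "b dvd k" "a dvd k" using * k by (auto simp: mult.commute)
    then have "a * b dvd k" using assms by (intro divides_mult)
    then show ?thesis using k by (metis mult.commute mult.assoc mult_dvd_mono dvd_refl)
  qed (use k in auto)
next
  assume *: "a * (b * c) dvd i"
  show "b * c dvd i" using * by (rule dvd_mult_right)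
  show "a * c dvd i" using * by (metis dvd_mult_right mult.left_commute)
qed

text \<open>Any two of the three indicators multiply to the indicator \<open>w\<close> of multiples
  of \<open>a * b * c\<close>. The expanded product is therefore linear in the indicators, whose
  sums over one period are \<open>a\<close>, \<open>b\<close>, \<open>c\<close> and 1.\<close>

lemma sum_jump_mult:
  assumes pos: "a > 0" "b > 0" "c > 0" and "coprime a b" "coprime a c" "coprime b c"
  shows "(\<Sum>i<a * (b * c). (1 / real (b * c) - of_bool (b * c dvd i)) *
      (1 / real (a * c) - of_bool (a * c dvd i)) * (1 / real (a * b) - of_bool (a * b dvd i))) =
    (real a + real b + real c - 2) / (real a * real b * real c) - 1"
proof -
  define N where "N = a * (b * c)"
  define w :: "nat \<Rightarrow> real" where "w i = of_bool (N dvd i)" for i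
  define x y z :: "nat \<Rightarrow> real" where
    "x i = of_bool (b * c dvd i)" and "y i = of_bool (a * c dvd i)" and
    "z i = of_bool (a * b dvd i)" for i
  define \<alpha> \<beta> \<gamma> where "\<alpha> = 1 / real (b * c)" and "\<beta> = 1 / real (a * c)" and "\<gamma> = 1 / real (a * b)"
  have xy: "x i * y i = w i" for i
    using mult_dvd_and_mult_dvd_iff[of a b c i] assms by (auto simp: x_def y_def w_def N_def)
  have xz: "x i * z i = w i" for i
    using mult_dvd_and_mult_dvd_iff[of a c b i] assms
    by (auto simp: x_def z_def w_def N_def mult.commute[of c b])
  have yz: "y i * z i = w i" for i
    using mult_dvd_and_mult_dvd_iff[of b c a i] assms
    by (auto simp: y_def z_def w_def N_def mult.commute mult.left_commute coprime_commute)
  have xw: "x i * w i = w i" for i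
    by (auto simp: x_def w_def N_def)
  have expand: "(\<alpha> - x i) * (\<beta> - y i) * (\<gamma> - z i) =
      \<alpha> * \<beta> * \<gamma> - \<alpha> * \<beta> * z i - \<alpha> * \<gamma> * y i - \<beta> * \<gamma> * x i + (\<alpha> + \<beta> + \<gamma> - 1) * w i" for i
  proof -
    have "(\<alpha> - x i) * (\<beta> - y i) * (\<gamma> - z i) =
      \<alpha> * \<beta> * \<gamma> - \<alpha> * \<beta> * z i - \<alpha> * \<gamma> * y i - \<beta> * \<gamma> * x i
      + \<alpha> * (y i * z i) + \<beta> * (x i * z i) + \<gamma> * (x i * y i) - x i * (y i * z i)"
      by (simp add: algebra_simps)
    then show ?thesis unfolding xy xz yz xw by (simp add: algebra_simps)
  qed
  have "sum x {..<N} = a" "sum y {..<N} = b" "sum z {..<N} = c" "sum w {..<N} = 1"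
    using sum_of_bool_dvd_mult[of "b * c" "\<lambda>_. 1" a] sum_of_bool_dvd_mult[of "a * c" "\<lambda>_. 1" b]
      sum_of_bool_dvd_mult[of "a * b" "\<lambda>_. 1" c] sum_of_bool_dvd_mult[of N "\<lambda>_. 1" 1] pos
    by (simp_all add: N_def x_def y_def z_def w_def mult.commute mult.left_commute)
  then have "(\<Sum>i<N. (\<alpha> - x i) * (\<beta> - y i) * (\<gamma> - z i)) =
      N * (\<alpha> * \<beta> * \<gamma>) - \<alpha> * \<beta> * c - \<alpha> * \<gamma> * b - \<beta> * \<gamma> * a + (\<alpha> + \<beta> + \<gamma> - 1)"
    unfolding expand by (simp add: sum.distrib sum_subtractf flip: sum_distrib_left)
  also have "\<dots> = (real a + real b + real c - 2) / (real a * real b * real c) - 1"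
    using pos by (simp add: N_def \<alpha>_def \<beta>_def \<gamma>_def field_simps)
  finally show ?thesis
    by (simp only: N_def x_def y_def z_def \<alpha>_def \<beta>_def \<gamma>_def)
qed

text \<open>\<open>F\<close> has period \<open>N = a * b * c\<close>, so its increments
  \<open>G\<close> sum to zero over a period. The summands of \<open>G\<close> are evaluated by
  \<open>sum_jump_sawtooth_mult\<close>, which contributes the three Dedekind sums, and by
  \<open>sum_jump_mult\<close>.\<close>

theorem dedekind_product_sum_three_term:
  assumes pos: "a > 0" "b > 0" "c > 0" and cop: "coprime a b" "coprime a c" "coprime b c"
  shows "dedekind_product_sum b c a + dedekind_product_sum a c b + dedekind_product_sum a b c =
    (real a ^ 2 + real b ^ 2 + real c ^ 2) / (12 * real a * real b * real c) - 1 / 4"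
proof -
  define N where "N = a * (b * c)"
  define X where "X n i = sawtooth (real i / real n)" for n i :: nat
  \<comment> \<open>\<open>D n i\<close> is the increment of the midpoint value from
    \<open>i - 1\<close> to \<open>i\<close>; \<open>X n i\<close> is the mean of these two
    values.\<close>
  define D where "D n i = 1 / real n - of_bool (n dvd i)" for n i :: nat
  define F where "F i = sawtooth_mid (b * c) i * sawtooth_mid (a * c) i * sawtooth_mid (a * b) i" for i
  define G where "G i = D (b * c) i * (X (a * c) i * X (a * b) i)
      + D (a * c) i * (X (b * c) i * X (a * b) i) + D (a * b) i * (X (b * c) i * X (a * c) i)
      + D (b * c) i * D (a * c) i * D (a * b) i / 4" for i
  have dvdN: "b * c dvd N" "a * c dvd N" "a * b dvd N"
    by (simp_all add: N_def mult.left_commute[of a b c])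
  \<comment> \<open>In the product of the \<open>X + D / 2\<close> minus the product of the
    \<open>X - D / 2\<close> only terms odd in \<open>D\<close> survive: three with one
    \<open>D\<close>, and the triple product with factor \<open>2 / 8\<close>.\<close>
  have FG: "F (Suc i) - F i = G (Suc i)" for i
  proof -
    have "sawtooth_mid n i = X n (Suc i) - D n (Suc i) / 2" if "n > 0" for n
      using sawtooth_mid_eq_Suc[OF that] by (simp add: X_def D_def)
    then have "F i = (X (b * c) (Suc i) - D (b * c) (Suc i) / 2) *
        (X (a * c) (Suc i) - D (a * c) (Suc i) / 2) * (X (a * b) (Suc i) - D (a * b) (Suc i) / 2)"
      using pos by (simp add: F_def)
    moreover have "F (Suc i) = (X (b * c) (Suc i) + D (b * c) (Suc i) / 2) *
        (X (a * c) (Suc i) + D (a * c) (Suc i) / 2) * (X (a * b) (Suc i) + D (a * b) (Suc i) / 2)"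
      by (simp add: F_def sawtooth_mid_def X_def D_def)
    ultimately show ?thesis
      unfolding G_def by (simp add: field_simps)
  qed
  have X0: "X n N = X n 0" and D0: "D n N = D n 0" and "sawtooth_mid n N = sawtooth_mid n 0"
    if "n dvd N" for n
  proof -
    have "N > 0" using pos by (simp add: N_def)
    then have "n > 0" using that by (metis dvd_0_left gr0I less_irrefl)
    then show "X n N = X n 0" "D n N = D n 0" "sawtooth_mid n N = sawtooth_mid n 0"
      using that by (simp_all add: X_def D_def sawtooth_mid_def sawtooth_nat_quotient)
  qed
  then have "F N = F 0" "G N = G 0"
    using dvdN by (auto simp: F_def G_def)
  have "(\<Sum>i<N. G (Suc i)) = 0"
    using sum_lessThan_telescope[of F N] \<open>F N = F 0\<close> by (simp add: FG)
  then have "(\<Sum>i<N. G i) = 0"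
    using sum.lessThan_Suc[of G N] sum.lessThan_Suc_shift[of G N] \<open>G N = G 0\<close> by simp
  moreover have "(\<Sum>i<N. G i) =
      ((real a - 1) * (real a - 2) / (12 * real a * real b * real c) - dedekind_product_sum b c a)
    + ((real b - 1) * (real b - 2) / (12 * real b * real a * real c) - dedekind_product_sum a c b)
    + ((real c - 1) * (real c - 2) / (12 * real c * real a * real b) - dedekind_product_sum a b c)
    + ((real a + real b + real c - 2) / (real a * real b * real c) - 1) / 4"
  proof -
    have N_eq: "N = b * (a * c)" "N = c * (a * b)"
      by (simp_all add: N_def)
    have 1: "(\<Sum>i<N. D (b * c) i * (X (a * c) i * X (a * b) i)) =
        (real a - 1) * (real a - 2) / (12 * real a * real b * real c) - dedekind_product_sum b c a"
      unfolding N_def X_def D_def by (rule sum_jump_sawtooth_mult) (use assms in auto)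
    have 2: "(\<Sum>i<N. D (a * c) i * (X (b * c) i * X (a * b) i)) =
        (real b - 1) * (real b - 2) / (12 * real b * real a * real c) - dedekind_product_sum a c b"
      unfolding N_eq(1) X_def D_def mult.commute[of a b]
      by (rule sum_jump_sawtooth_mult) (use assms in auto)
    have 3: "(\<Sum>i<N. D (a * b) i * (X (b * c) i * X (a * c) i)) =
        (real c - 1) * (real c - 2) / (12 * real c * real a * real b) - dedekind_product_sum a b c"
      unfolding N_eq(2) X_def D_def mult.commute[of b c] mult.commute[of a c]
      by (rule sum_jump_sawtooth_mult) (use assms in auto)
    have 4: "(\<Sum>i<N. D (b * c) i * D (a * c) i * D (a * b) i) =
        (real a + real b + real c - 2) / (real a * real b * real c) - 1"
      unfolding N_def D_def by (rule sum_jump_mult) (use assms in auto)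
    show ?thesis
      unfolding G_def sum.distrib sum_divide_distrib[symmetric] 1 2 3 4 by simp
  qed
  moreover have "(real a - 1) * (real a - 2) / (12 * real a * real b * real c)
    + (real b - 1) * (real b - 2) / (12 * real b * real a * real c)
    + (real c - 1) * (real c - 2) / (12 * real c * real a * real b)
    + ((real a + real b + real c - 2) / (real a * real b * real c) - 1) / 4 =
    (real a ^ 2 + real b ^ 2 + real c ^ 2) / (12 * real a * real b * real c) - 1 / 4"
    using pos by (simp add: divide_simps) (simp add: algebra_simps power2_eq_square)
  ultimately show ?thesis
    by linarith
qed

section \<open>Invariance properties and the link to the classical sum\<close>

lemma dedekind_product_sum_commute:
  "dedekind_product_sum x y z = dedekind_product_sum y x z"
  by (simp add: dedekind_product_sum_def mult.commute)

lemma dedekind_product_sum_1_right [simp]: "dedekind_product_sum x y 1 = 0"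
  by (simp add: dedekind_product_sum_def)

lemma dedekind_product_sum_cong:
  assumes "[x = x'] (mod z)" "[y = y'] (mod z)"
  shows "dedekind_product_sum x y z = dedekind_product_sum x' y' z"
proof (cases "z = 0")
  case False
  have "sawtooth (real (u * j) / real z) = sawtooth (real (v * j) / real z)"
    if "[u = v] (mod z)" for u v j
  proof -
    have "(u * j) mod z = (v * j) mod z"
      using cong_scalar_right[OF that, of j] by (simp add: cong_def)
    then show ?thesis using sawtooth_mod False by (metis gr0I)
  qed
  then show ?thesis
    unfolding dedekind_product_sum_def using assms by (intro sum.cong) metis+
qed (simp add: dedekind_product_sum_def)

text \<open>Multiplication by the unit \<open>m\<close> permutes the residues modulo
  \<open>z\<close>.\<close>

lemma dedekind_product_sum_mult:
  assumes "coprime m z"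
  shows "dedekind_product_sum (x * m) (y * m) z = dedekind_product_sum x y z"
proof (cases "z = 0")
  case False
  then have z: "z > 0" by simp
  have inj: "inj_on (\<lambda>j. m * j mod z) {..<z}"
  proof (rule inj_onI)
    fix i j assume *: "i \<in> {..<z}" "j \<in> {..<z}" "m * i mod z = m * j mod z"
    then have "[i = j] (mod z)"
      using assms cong_mult_lcancel_nat[of m z i j] by (simp add: cong_def)
    then show "i = j" using * by (simp add: cong_def)
  qed
  then have bij: "bij_betw (\<lambda>j. m * j mod z) {..<z} {..<z}"
    using z unfolding bij_betw_def by (intro conjI endo_inj_surj) auto
  have *: "sawtooth (real (x * (m * j mod z)) / real z) = sawtooth (real (x * m * j) / real z)" for x j
    using sawtooth_mod[OF z] by (metis mod_mult_right_eq mult.assoc)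
  show ?thesis
    unfolding dedekind_product_sum_def
    by (subst sum.reindex_bij_betw[OF bij, symmetric]) (simp only: *)
qed (simp add: dedekind_product_sum_def)

lemma dedekind_sum_of_nat: "dedekind_sum (int a) b = dedekind_product_sum 1 a b"
proof (cases "b = 0")
  case False
  define f where "f j = sawtooth (real (1 * j) / real b) * sawtooth (real (a * j) / real b)" for j
  \<comment> \<open>The ranges \<open>{1..b}\<close> and \<open>{..<b}\<close> differ only in the
    indices 0 and \<open>b\<close>, where the summand vanishes.\<close>
  have "f 0 = 0" "f b = 0" using False by (simp_all add: f_def)
  have "sum f {1..b} = sum f {..<b}"
    by (rule sum.mono_neutral_cong) (use \<open>f 0 = 0\<close> \<open>f b = 0\<close> in \<open>auto simp: not_less_eq_eq le_antisym\<close>)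
  then show ?thesis
    by (simp add: dedekind_sum_def dedekind_product_sum_def f_def)
qed (simp add: dedekind_sum_def dedekind_product_sum_def)

lemma dedekind_sum_uminus: "dedekind_sum (- a) b = - dedekind_sum a b"
  by (simp add: dedekind_sum_def sawtooth_uminus sum_negf)

lemma dedekind_sum_mod: "dedekind_sum (a mod int b) b = dedekind_sum a b"
proof (cases "b = 0")
  case False
  have "sawtooth (of_int a * real j / real b) = sawtooth (of_int (a mod int b) * real j / real b)" for j
  proof -
    have "of_int a = of_int (a mod int b) + real b * of_int (a div int b)"
      by (metis mod_mult_div_eq of_int_add of_int_mult of_int_of_nat_eq)
    then have "of_int a * real j / real b =
        of_int (a mod int b) * real j / real b + of_int (a div int b * int j)"
      using False by (simp add: field_simps)
    then show ?thesis by (metis sawtooth_add_of_int)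
  qed
  then show ?thesis by (simp add: dedekind_sum_def)
qed (simp add: dedekind_sum_def)

section \<open>Reciprocity and integrality\<close>

text \<open>The three-term relation with \<open>c = 1\<close>, where the sum modulo 1
  vanishes.\<close>

lemma dedekind_reciprocity:
  assumes "a > 0" "b > 0" "coprime a b"
  shows "dedekind_product_sum 1 a b + dedekind_product_sum 1 b a =
    (real a ^ 2 + real b ^ 2 + 1) / (12 * real a * real b) - 1 / 4"
  using dedekind_product_sum_three_term[of a b 1] assms
    dedekind_product_sum_commute[of a 1 b] dedekind_product_sum_commute[of b 1 a]
    dedekind_product_sum_1_right[of a b] by simp

text \<open>Substituting \<open>r j = a * j - b * w j\<close> into the expanded summand leaves
  \<open>12 * a / b * j^2\<close> as its only possibly non-integral part, and \<open>b\<close>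
  cancels when this is summed over \<open>j < b\<close>.\<close>

lemma dedekind_product_sum_Ints:
  assumes "b > 0" "coprime a b"
  shows "12 * real b * dedekind_product_sum 1 a b \<in> \<int>"
proof -
  define r w where "r j = a * j mod b" and "w j = a * j div b" for j
  have "12 * real b * dedekind_product_sum 1 a b =
      (\<Sum>j<b. 12 * real b * (sawtooth (real j / real b) * sawtooth (real (a * j) / real b)))"
    by (simp add: dedekind_product_sum_def sum_distrib_left)
  also have "\<dots> = (\<Sum>j<b. 12 * real a / real b * (real j)\<^sup>2
      + of_int (if j = 0 then 0 else 3 * int b - 12 * int j * int (w j) - 6 * int j - 6 * int (r j)))"
  proof (intro sum.cong refl)
    fix j assume j: "j \<in> {..<b}"
    show "12 * real b * (sawtooth (real j / real b) * sawtooth (real (a * j) / real b)) =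
      12 * real a / real b * (real j)\<^sup>2
      + of_int (if j = 0 then 0 else 3 * int b - 12 * int j * int (w j) - 6 * int j - 6 * int (r j))"
    proof (cases "j = 0")
      case False
      have "\<not> b dvd j" using j False by (auto dest: dvd_imp_le)
      then have "\<not> b dvd a * j"
        using assms by (simp add: coprime_dvd_mult_right_iff coprime_commute)
      then have "sawtooth (real (a * j) / real b) = real (r j) / real b - 1 / 2"
        using assms(1) by (simp only: sawtooth_nat_quotient r_def if_False)
      moreover have "sawtooth (real j / real b) = real j / real b - 1 / 2"
        using j False by (intro sawtooth_unit_interval) auto
      ultimately have "12 * real b * (sawtooth (real j / real b) * sawtooth (real (a * j) / real b)) =
          12 * real j * real (r j) / real b - 6 * real j - 6 * real (r j) + 3 * real b"
        by (simp only:) (use assms(1) in \<open>simp add: field_simps\<close>)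
      moreover have "real (r j) = real a * real j - real b * real (w j)"
      proof -
        have "real (a * j) = real (r j + b * w j)"
          unfolding r_def w_def by (simp only: mod_mult_div_eq)
        then show ?thesis by simp
      qed
      then have "12 * real j * real (r j) / real b =
          12 * real a / real b * (real j)\<^sup>2 - 12 * real j * real (w j)"
        by (simp only:) (use assms(1) in \<open>simp add: field_simps power2_eq_square\<close>)
      ultimately show ?thesis using False by simp
    qed simp
  qed
  also have "\<dots> = 12 * real a / real b * (real b * (real b - 1) * (2 * real b - 1) / 6)
      + (\<Sum>j<b. of_int (if j = 0 then 0 else 3 * int b - 12 * int j * int (w j) - 6 * int j - 6 * int (r j)))"
    by (simp only: sum.distrib sum_distrib_left[symmetric] sum_of_nat_squares_lessThan)
  also have "12 * real a / real b * (real b * (real b - 1) * (2 * real b - 1) / 6) =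
      of_int (2 * int a * (int b - 1) * (2 * int b - 1))"
    using assms(1) by (simp add: field_simps)
  also have "of_int (2 * int a * (int b - 1) * (2 * int b - 1))
      + (\<Sum>j<b. of_int (if j = 0 then 0 else 3 * int b - 12 * int j * int (w j) - 6 * int j - 6 * int (r j)))
      \<in> (\<int> :: real set)"
    by (intro Ints_add Ints_of_int Ints_sum)
  finally show ?thesis .
qed

section \<open>The shift formula\<close>

lemma coprime_factor_square_plus_one:
  fixes a g h :: nat
  assumes "g * h = a\<^sup>2 + 1"
  shows "coprime a g" "coprime a h"
proof -
  have "coprime a (a\<^sup>2 + 1)"
    by (metis coprime_add_one_right coprime_commute coprime_mult_left_iff power2_eq_square)
  then have "coprime a (g * h)" by (simp only: assms)
  then show "coprime a g" "coprime a h" by simp_all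
qed

text \<open>The sum \<open>s(qg, a)\<close> produced by reciprocity equals \<open>\<Sum>((hj/a))((qj/a))\<close> because
  \<open>gh \<equiv> 1 (mod a)\<close>, so the three-term relation applies to it.\<close>

lemma dedekind_sum_via_cofactor:
  assumes pos: "a > 0" "q > 0" and gh: "g * h = a\<^sup>2 + 1"
    and cop: "coprime a q" "coprime h q"
  shows "12 * dedekind_product_sum 1 a (q * g) =
    (real q ^ 2 - 1) * real a / (real q * real h)
    + 12 * dedekind_product_sum a h q + 12 * dedekind_product_sum a q h"
proof -
  have g: "g > 0" and h: "h > 0" using gh by (auto intro!: gr0I)
  note cop_a = coprime_factor_square_plus_one[OF gh]
  have R: "dedekind_product_sum 1 a (q * g) + dedekind_product_sum 1 (q * g) a =
      (real a ^ 2 + real (q * g) ^ 2 + 1) / (12 * real a * real (q * g)) - 1 / 4"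
    using pos g cop cop_a by (intro dedekind_reciprocity) auto
  have "dedekind_product_sum 1 (q * g) a = dedekind_product_sum (1 * h) (q * g * h) a"
    by (subst dedekind_product_sum_mult) (use cop_a in \<open>simp_all add: coprime_commute\<close>)
  also have "\<dots> = dedekind_product_sum h q a"
  proof (intro dedekind_product_sum_cong)
    have "q * g * h = q + a * (a * q)"
      using gh by (simp add: mult.assoc) (simp add: algebra_simps power2_eq_square)
    then show "[q * g * h = q] (mod a)" by (simp add: cong_def)
  qed simp
  finally have 1: "dedekind_product_sum 1 (q * g) a = dedekind_product_sum h q a" .
  have T: "dedekind_product_sum h q a + dedekind_product_sum a q h + dedekind_product_sum a h q =
    (real a ^ 2 + real h ^ 2 + real q ^ 2) / (12 * real a * real h * real q) - 1 / 4"
    using pos h cop cop_a by (intro dedekind_product_sum_three_term) auto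
  have G: "real a ^ 2 + 1 = real g * real h"
    by (metis gh of_nat_1 of_nat_add of_nat_mult of_nat_power)
  \<comment> \<open>Up to the factor 12, the fractions in \<open>R\<close> and \<open>T\<close> are
    brought to the common denominator \<open>a * h * q\<close>, with \<open>g\<close> cancelling by
    \<open>G\<close>; their numerators then differ by \<open>(q^2 - 1) * a^2\<close>.\<close>
  have "(real a ^ 2 + real (q * g) ^ 2 + 1) / (real a * real (q * g)) =
      (real h ^ 2 + real q ^ 2 * (real a ^ 2 + 1)) / (real a * real h * real q)"
  proof -
    have "real a ^ 2 + real (q * g) ^ 2 + 1 = (real a ^ 2 + 1) + real (q * g) ^ 2"
      by simp
    also have "\<dots> = real g * (real h + real q ^ 2 * real g)"
      unfolding G by (simp add: algebra_simps power2_eq_square)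
    finally have num: "real a ^ 2 + real (q * g) ^ 2 + 1 = real g * (real h + real q ^ 2 * real g)" .
    show ?thesis
      unfolding num G using g h pos by (simp add: field_simps power2_eq_square)
  qed
  moreover have "(real h ^ 2 + real q ^ 2 * (real a ^ 2 + 1)) / (real a * real h * real q)
      - (real a ^ 2 + real h ^ 2 + real q ^ 2) / (real a * real h * real q) =
      (real q ^ 2 - 1) * real a / (real q * real h)"
    unfolding diff_divide_distrib[symmetric]
    using pos h by (simp add: divide_simps) (simp add: algebra_simps power2_eq_square)
  ultimately have U: "(real a ^ 2 + real (q * g) ^ 2 + 1) / (real a * real (q * g))
      - (real a ^ 2 + real h ^ 2 + real q ^ 2) / (real a * real h * real q) =
      (real q ^ 2 - 1) * real a / (real q * real h)"
    by simp
  have twelfth: "x / (12 * real a * real (q * g)) = x / (real a * real (q * g)) / 12"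
    "x / (12 * real a * real h * real q) = x / (real a * real h * real q) / 12" for x
    by (simp_all add: divide_divide_eq_left mult_ac)
  \<comment> \<open>Subtracting \<open>T\<close> from \<open>R\<close> eliminates the shared sum
    modulo \<open>a\<close> and the constant 1/4; in abstract variables this is linear
    arithmetic.\<close>
  have "12 * x = d + 12 * w + 12 * z"
    if "u - v = d" "x + y = u / 12 - 1 / 4" "y + z + w = v / 12 - 1 / 4" for d u v w x y z :: real
    using that by (simp add: field_simps)
  from this[OF U R[unfolded twelfth 1] T[unfolded twelfth]] show ?thesis .
qed

text \<open>\<open>g'\<close> is the cofactor for which \<open>g' * h = a'^2 + 1\<close> again
  holds. As \<open>a'\<close> agrees with \<open>a\<close> modulo \<open>q\<close> and modulo
  \<open>h\<close>, the two remaining Dedekind sums do not change, and only the term linear in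
  \<open>a\<close> grows.\<close>

lemma dedekind_sum_shift:
  fixes a q g h m :: nat
  assumes "a > 0" "q > 0" and gh: "g * h = a\<^sup>2 + 1"
    and cop: "coprime a q" "coprime h q"
  defines "a' \<equiv> a + q * h * m" and "g' \<equiv> g + 2 * a * q * m + h * q\<^sup>2 * m\<^sup>2"
  shows "coprime a' (q * g')"
    and "12 * dedekind_product_sum 1 a' (q * g') =
      12 * dedekind_product_sum 1 a (q * g) + (real q ^ 2 - 1) * real m"
proof -
  have h: "h > 0" using gh by (auto intro!: gr0I)
  have gh': "g' * h = a'\<^sup>2 + 1"
  proof -
    have "g' * h = g * h + 2 * a * q * m * h + h * q\<^sup>2 * m\<^sup>2 * h"
      by (simp add: g'_def algebra_simps)
    then show ?thesis unfolding gh
      by (simp add: a'_def algebra_simps power2_eq_square)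
  qed
  have q': "coprime a' q"
  proof -
    have "[a' = a] (mod q)" by (simp add: a'_def cong_def mult.assoc)
    then show ?thesis using cop(1) by (metis cong_imp_coprime cong_sym)
  qed
  then show "coprime a' (q * g')"
    using coprime_factor_square_plus_one(1)[OF gh'] by simp
  have "dedekind_product_sum a' h q = dedekind_product_sum a h q"
    by (rule dedekind_product_sum_cong) (simp_all add: a'_def cong_def mult.assoc)
  moreover have "dedekind_product_sum a' q h = dedekind_product_sum a q h"
    by (rule dedekind_product_sum_cong) (simp_all add: a'_def cong_def mult.assoc mult.left_commute[of q h])
  moreover have "(real q ^ 2 - 1) * real a' / (real q * real h) =
      (real q ^ 2 - 1) * real a / (real q * real h) + (real q ^ 2 - 1) * real m"
    using h assms(2) by (simp add: a'_def field_simps)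
  moreover have "a' > 0" using assms(1) by (simp add: a'_def)
  ultimately show "12 * dedekind_product_sum 1 a' (q * g') =
      12 * dedekind_product_sum 1 a (q * g) + (real q ^ 2 - 1) * real m"
    using dedekind_sum_via_cofactor[OF _ assms(2) gh' q' cop(2)]
      dedekind_sum_via_cofactor[OF assms(1,2) gh cop] by simp
qed

section \<open>Shape of the denominator and conclusion\<close>

text \<open>Integrality gives \<open>K * q = k * b\<close>, so \<open>q\<close> divides
  \<open>b = q * g\<close> and \<open>K = k * g\<close>. In the reciprocity law multiplied by
  \<open>12 * a * b\<close> every term except \<open>a^2 + 1\<close> is then visibly divisible by
  \<open>g\<close>.\<close>

lemma dedekind_value_denominator:
  assumes "a > 0" "b > 0" "coprime a b" "q > 0" "coprime k (int q)"
    and val: "of_int k / real q = 12 * dedekind_product_sum 1 a b"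
  obtains g h where "b = q * g" "g * h = a\<^sup>2 + 1" "coprime h q"
proof -
  obtain K where K: "12 * real b * dedekind_product_sum 1 a b = of_int K"
    using dedekind_product_sum_Ints[of b a] assms by (auto elim: Ints_cases)
  obtain L where L: "12 * real a * dedekind_product_sum 1 b a = of_int L"
    using dedekind_product_sum_Ints[of a b] assms by (auto elim: Ints_cases simp: coprime_commute)
  have "real_of_int (K * int q) = of_int (k * int b)"
    using K val assms(4) by (simp add: field_simps)
  then have Kq: "K * int q = k * int b" by (simp only: of_int_eq_iff)
  then have "int q dvd k * int b" by (metis dvd_triv_right)
  then have "int q dvd int b" using assms(5) by (simp add: coprime_dvd_mult_right_iff coprime_commute)
  then obtain g where g: "b = q * g" unfolding int_dvd_int_iff by (elim dvdE)
  then have Kg: "K = k * int g" using Kq assms(4) by simp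
  have "real_of_int (int a * K + int b * L) = of_int ((int a)\<^sup>2 + (int b)\<^sup>2 + 1 - 3 * int a * int b)"
  proof -
    have "real a * (12 * real b * dedekind_product_sum 1 a b)
        + real b * (12 * real a * dedekind_product_sum 1 b a) =
        12 * real a * real b * (dedekind_product_sum 1 a b + dedekind_product_sum 1 b a)"
      by (simp add: algebra_simps)
    also have "\<dots> = real a ^ 2 + real b ^ 2 + 1 - 3 * real a * real b"
      unfolding dedekind_reciprocity[OF assms(1-3)] using assms(1,2) by (simp add: field_simps)
    finally show ?thesis unfolding K L by simp
  qed
  then have eq: "int a * K + int b * L = (int a)\<^sup>2 + (int b)\<^sup>2 + 1 - 3 * int a * int b"
    by (simp only: of_int_eq_iff)
  \<comment> \<open>The quotient by \<open>g\<close> of the terms other than \<open>a^2 + 1\<close>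
    in \<open>eq\<close>. It is congruent to \<open>a * k\<close> modulo \<open>q\<close>, hence
    coprime to \<open>q\<close>.\<close>
  define h where "h = int a * k + int q * (L + 3 * int a - int b)"
  have gh: "int g * h = (int a)\<^sup>2 + 1"
    using eq by (simp add: h_def Kg g algebra_simps power2_eq_square)
  have "h > 0"
  proof -
    have "0 < int g * h" unfolding gh by (simp add: add_nonneg_pos)
    then show ?thesis by (simp add: zero_less_mult_iff)
  qed
  have "coprime (int a) (int q)" using assms(3) g by simp
  then have "coprime (int a * k) (int q)" using assms(5) by simp
  then have "coprime h (int q)" unfolding h_def
    by (metis cong_imp_coprime cong_add_lcancel_0 cong_mult_self_left cong_sym)
  moreover have "int (g * nat h) = int (a\<^sup>2 + 1)"
    using gh \<open>h > 0\<close> by simp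
  then have "g * nat h = a\<^sup>2 + 1" by (simp only: of_nat_eq_iff)
  ultimately show thesis
    using that[of g "nat h"] g \<open>h > 0\<close> by (simp flip: coprime_int_iff)
qed

lemma normalized_dedekind_value_uminus:
  assumes "normalized_dedekind_value r"
  shows "normalized_dedekind_value (- r)"
proof -
  obtain a b where "b > 0" "coprime a (int b)" "r = 12 * dedekind_sum a b"
    using assms by (auto simp: normalized_dedekind_value_def normalized_dedekind_sum_def)
  then have "b > 0 \<and> coprime (- a) (int b) \<and> - r = 12 * dedekind_sum (- a) b"
    by (simp add: dedekind_sum_uminus)
  then show ?thesis
    unfolding normalized_dedekind_value_def normalized_dedekind_sum_def by blast
qed

lemma normalized_dedekind_value_shift_nat:
  fixes q m :: nat and k :: int
  assumes "q > 1" and "coprime k (int q)"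
    and "normalized_dedekind_value (of_int k / real q)"
  shows "normalized_dedekind_value (of_int k / real q + (real q ^ 2 - 1) * real m)"
proof -
  obtain a0 b where b: "b > 0" and a0: "coprime a0 (int b)" and
      val0: "of_int k / real q = 12 * dedekind_sum a0 b"
    using assms(3) by (auto simp: normalized_dedekind_value_def normalized_dedekind_sum_def)
  \<comment> \<open>The numerator is reduced modulo \<open>b\<close> to a natural number, as the
    product sums require.\<close>
  define a where "a = nat (a0 mod int b)"
  have a: "int a = a0 mod int b" using b by (simp add: a_def)
  have val: "of_int k / real q = 12 * dedekind_product_sum 1 a b"
    using val0 a dedekind_sum_of_nat[of a b] by (simp add: dedekind_sum_mod)
  have cop: "coprime a b"
    using a0 a b by (metis coprime_int_iff coprime_mod_left_iff of_nat_0_less_iff less_irrefl)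
  \<comment> \<open>Only 1 is coprime to 0, so \<open>q > 1\<close> excludes \<open>k = 0\<close>.
    Since the sums modulo 1 vanish, \<open>b = 1\<close> is excluded too, and then coprimality rules
    out \<open>a = 0\<close>.\<close>
  have "k \<noteq> 0" using assms(1,2) by auto
  then have "b \<noteq> 1" using val assms(1) dedekind_product_sum_1_right[of 1 a] by auto
  then have "a > 0" using cop by (auto intro!: gr0I)
  obtain g h where gh: "b = q * g" "g * h = a\<^sup>2 + 1" "coprime h q"
    using dedekind_value_denominator[OF \<open>a > 0\<close> b cop _ assms(2) val] assms(1) by auto
  have "coprime a q" using cop gh by simp
  note shift = dedekind_sum_shift[OF \<open>a > 0\<close> _ gh(2) this gh(3), of m]
  define a' g' where "a' = a + q * h * m" and "g' = g + 2 * a * q * m + h * q\<^sup>2 * m\<^sup>2"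
  have "q * g' > 0" using b gh(1) by (auto simp: g'_def)
  moreover have "coprime (int a') (int (q * g'))"
    using shift(1) assms(1) by (simp only: a'_def g'_def coprime_int_iff)
  moreover have "of_int k / real q + (real q ^ 2 - 1) * real m = 12 * dedekind_sum (int a') (q * g')"
    using shift(2) assms(1) val gh(1) by (simp only: a'_def g'_def dedekind_sum_of_nat)
  ultimately show ?thesis
    unfolding normalized_dedekind_value_def normalized_dedekind_sum_def by blast
qed

theorem theorem1:
  fixes q :: nat and k :: int
  assumes "q > 0"
    and "coprime k (int q)"
    and "normalized_dedekind_value (of_int k / real q)"
  shows "\<forall>k'::int. [k' = k] (mod (((int q)\<^sup>2 - 1) * int q)) \<longrightarrow>
           normalized_dedekind_value (of_int k' / real q)"
proof (intro allI impI)
  fix k' :: int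
  assume "[k' = k] (mod (((int q)\<^sup>2 - 1) * int q))"
  then obtain n where n: "k' = k + ((int q)\<^sup>2 - 1) * int q * n"
    by (metis cong_iff_lin cong_sym)
  show "normalized_dedekind_value (of_int k' / real q)"
  proof (cases "q = 1")
    \<comment> \<open>For \<open>q = 1\<close> the modulus is 0, so \<open>k' = k\<close>.\<close>
    case True
    then show ?thesis using n assms(3) by simp
  next
    case False
    then have q: "q > 1" using assms(1) by simp
    have eq: "of_int k' / real q = of_int k / real q + (real q ^ 2 - 1) * of_int n"
      using q by (simp add: n field_simps)
    show ?thesis
    proof (cases "n \<ge> 0")
      case True
      then show ?thesis
        using normalized_dedekind_value_shift_nat[OF q assms(2,3), of "nat n"] by (simp add: eq)
    next
      case False
      \<comment> \<open>For negative \<open>n\<close> the value \<open>-k/q\<close> is shifted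
        upwards by \<open>-n\<close> steps and the result is negated.\<close>
      have "normalized_dedekind_value (of_int (- k) / real q)"
        using normalized_dedekind_value_uminus[OF assms(3)] by simp
      then have "normalized_dedekind_value (of_int (- k) / real q + (real q ^ 2 - 1) * real (nat (- n)))"
        using assms(2) by (intro normalized_dedekind_value_shift_nat[OF q]) simp_all
      then have "normalized_dedekind_value (- (of_int (- k) / real q + (real q ^ 2 - 1) * real (nat (- n))))"
        by (rule normalized_dedekind_value_uminus)
      then show ?thesis using False by (simp add: eq add.commute)
    qed
  qed
qed

end
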